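(* Suppose that $\{\epsilon^k\}$ is a sequence of (componentwise) non-increasing positive vectors in $\mathbb{R}^n$ and $\epsilon^k\to0$ as $k\to\infty$. Let $x^0\in\mathbb{R}^n$ be arbitrary and let $\{x^k\}$ be a sequence generated by $$x^{k+1}\in\mathrm{Arg\,min}_{x\in\mathbb{R}^n}\left\{f(x)+\frac{\lambda p}{\alpha}\sum_{i=1}^n s^k_i|x_i|^\alpha\right\},\qquad s^k_i=(|x^k_i|^\alpha+\epsilon^k_i)^{\frac p\alpha-1}\ \ \forall i,\qquad k\ge0.$$ Suppose that $x^*$ is an accumulation point of $\{x^k\}$. Then $x^*$ is a (first-order) stationary point of $\min_{x\in\mathbb{R}^n}\{F(x)=f(x)+\lambda\|x\|_p^p\}$.
   Context: Here $\lambda>0$, $p\in(0,1)$, $\alpha\ge1$, and $f:\mathbb{R}^n\to\mathbb{R}$ is continuously differentiable, bounded below, with $L_f$-Lipschitz continuous gradient: $\|\nabla f(x)-\nabla f(y)\|_2\le L_f\|x-y\|_2$ for all $x,y$. $\|x\|_p^p=\sum_i|x_i|^p$. A vector $x^*$ is a first-order stationary point of $\min F$ if $x^*_i\,\partial f(x^* )/\partial x_i+\lambda p|x^*_i|^p=0$ for all $i=1,\dots,n$. *)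

theory Defs
  imports "HOL-Analysis.Analysis"
begin

definition partial_deriv :: "(real ^ 'n \<Rightarrow> real) \<Rightarrow> 'n \<Rightarrow> real ^ 'n \<Rightarrow> real" where
  "partial_deriv f i x = deriv (\<lambda>t. f (x + t *\<^sub>R axis i 1)) 0"

definition gradient :: "(real ^ 'n \<Rightarrow> real) \<Rightarrow> real ^ 'n \<Rightarrow> real ^ 'n" where
  "gradient f x = (\<chi> i. partial_deriv f i x)"

text \<open>First-order stationary points of the minimisation over \<open>real ^ 'n\<close> of
  \<open>F x = f x + lam * (\<Sum>i\<in>UNIV. \<bar>x $ i\<bar> powr p)\<close>. As \<open>F\<close> is not differentiable
  where a coordinate vanishes, the gradient equation is multiplied by \<open>x $ i\<close>; this is
  vacuous at \<open>x $ i = 0\<close>, since \<open>0 powr p = 0\<close>.\<close>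

definition lp_stationary_point ::
    "real \<Rightarrow> real \<Rightarrow> (real ^ 'n \<Rightarrow> real) \<Rightarrow> real ^ 'n \<Rightarrow> bool" where
  "lp_stationary_point lam p f x \<longleftrightarrow>
     (\<forall>i. x $ i * partial_deriv f i x + lam * p * \<bar>x $ i\<bar> powr p = 0)"

definition irl_weight :: "real \<Rightarrow> real \<Rightarrow> real ^ 'n \<Rightarrow> real ^ 'n \<Rightarrow> real ^ 'n" where
  "irl_weight \<alpha> p \<epsilon> x = (\<chi> i. (\<bar>x $ i\<bar> powr \<alpha> + \<epsilon> $ i) powr (p / \<alpha> - 1))"

definition reweighted_objective ::
    "real \<Rightarrow> real \<Rightarrow> real \<Rightarrow> (real ^ 'n \<Rightarrow> real) \<Rightarrow> real ^ 'n \<Rightarrow> real ^ 'n \<Rightarrow> real" where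
  "reweighted_objective lam p \<alpha> f s x =
     f x + lam * p / \<alpha> * (\<Sum>i\<in>UNIV. s $ i * \<bar>x $ i\<bar> powr \<alpha>)"

definition accumulation_point :: "(nat \<Rightarrow> 'a::metric_space) \<Rightarrow> 'a \<Rightarrow> bool" where
  "accumulation_point X l \<longleftrightarrow> (\<exists>r. strict_mono r \<and> (X \<circ> r) \<longlonglongrightarrow> l)"

end

theory Submission
  imports Defs
begin

text \<open>
  Put \<open>F\<^sub>k y = f y + lam * (\<Sum>i. (\<bar>y\<^sub>i\<bar> powr \<alpha> + \<epsilon>\<^sup>k\<^sub>i) powr (p / \<alpha>))\<close> and let \<open>Q\<^sub>k\<close> be the
  objective minimised at step \<open>k\<close>. Concavity of \<open>t \<mapsto> t powr (p / \<alpha>)\<close> makes \<open>Q\<^sub>k\<close> a majorant of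
  \<open>F\<^sub>k\<close> up to a constant, with equality at \<open>x\<^sup>k\<close>, so
  \<open>0 \<le> Q\<^sub>k x\<^sup>k - Q\<^sub>k x\<^sup>k\<^sup>+\<^sup>1 \<le> F\<^sub>k x\<^sup>k - F\<^sub>k\<^sub>+\<^sub>1 x\<^sup>k\<^sup>+\<^sup>1\<close>. The sequence \<open>F\<^sub>k x\<^sup>k\<close> is therefore
  decreasing, and it is bounded below; hence \<open>x\<^sup>k\<close> minimises \<open>Q\<^sub>k\<close> up to an error tending to \<open>0\<close>.
  Comparing \<open>x\<^sup>k\<close> with its translates along a single axis \<open>i\<close> for which the limit point has a
  nonzero coordinate, all terms of \<open>Q\<^sub>k\<close> but the \<open>i\<close>-th cancel, and the weights converge. In the
  limit the one-variable function obtained is minimal at \<open>0\<close>; Fermat's rule is the claim.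
\<close>

text \<open>Young's inequality with weights \<open>q\<close> and \<open>1 - q\<close>, applied to
  \<open>b / a\<close> and \<open>1\<close>, is the tangent bound at base point 1; multiplying by
  \<open>a powr q\<close> moves it to \<open>a\<close>.\<close>

lemma powr_le_tangent:
  fixes a b q :: real
  assumes "0 < a" "0 < b" "0 \<le> q" "q \<le> 1"
  shows "b powr q \<le> a powr q + q * a powr (q - 1) * (b - a)"
proof -
  have "(b / a) powr q * 1 powr (1 - q) \<le> q * (b / a) + (1 - q) * 1"
    by (rule Youngs_inequality_0) (use assms in auto)
  then have "a powr q * (b / a) powr q \<le> a powr q * (q * (b / a) + (1 - q))"
    by (intro mult_left_mono) auto
  moreover have "a powr q * (b / a) powr q = b powr q"
    using assms by (simp add: powr_divide)
  moreover have "a powr q * (q * (b / a) + (1 - q)) = a powr q + q * (a powr q / a) * (b - a)"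
    using assms by (simp add: field_simps)
  moreover have "a powr q / a = a powr (q - 1)"
    using assms by (simp add: powr_diff)
  ultimately show ?thesis by simp
qed

text \<open>As long as \<open>\<bar>t\<bar> < \<bar>u\<bar>\<close>, the sign of
  \<open>u + t\<close> is that of \<open>u\<close>, so the absolute value is affine in
  \<open>t\<close>.\<close>

lemma has_real_derivative_abs_powr:
  fixes u r :: real
  assumes "u \<noteq> 0"
  shows "((\<lambda>t. \<bar>u + t\<bar> powr r) has_real_derivative r * \<bar>u\<bar> powr (r - 1) * sgn u) (at 0)"
proof (rule has_field_derivative_transform_within[where d = "\<bar>u\<bar>" and f = "\<lambda>t. (\<bar>u\<bar> + sgn u * t) powr r"])
  show "((\<lambda>t. (\<bar>u\<bar> + sgn u * t) powr r) has_real_derivative r * \<bar>u\<bar> powr (r - 1) * sgn u) (at 0)"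
    using assms by (auto intro!: derivative_eq_intros simp: powr_diff)
next
  fix t :: real
  assume "dist t 0 < \<bar>u\<bar>"
  then have "\<bar>u + t\<bar> = \<bar>u\<bar> + sgn u * t"
    by (cases "u > 0") (auto simp: dist_real_def sgn_if)
  then show "(\<bar>u\<bar> + sgn u * t) powr r = \<bar>u + t\<bar> powr r"
    by simp
qed (use assms in auto)

lemma has_real_derivative_partial_deriv:
  assumes "f differentiable (at x)"
  shows "((\<lambda>t. f (x + t *\<^sub>R axis i 1)) has_real_derivative partial_deriv f i x) (at 0)"
proof -
  have "f differentiable (at (x + 0 *\<^sub>R axis i 1))"
    using assms by simp
  then have "(f \<circ> (\<lambda>t. x + t *\<^sub>R axis i 1)) differentiable (at (0::real))"
    by (intro differentiable_chain_at) (auto intro!: derivative_intros)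
  then have "(\<lambda>t. f (x + t *\<^sub>R axis i 1)) field_differentiable (at 0)"
    by (simp add: o_def real_differentiable_def field_differentiable_def)
  then show ?thesis
    unfolding partial_deriv_def by (simp add: field_differentiable_derivI)
qed

definition smoothed_objective ::
    "real \<Rightarrow> real \<Rightarrow> real \<Rightarrow> (real ^ 'n \<Rightarrow> real) \<Rightarrow> real ^ 'n \<Rightarrow> real ^ 'n \<Rightarrow> real" where
  "smoothed_objective lam p \<alpha> f \<epsilon> x =
     f x + lam * (\<Sum>i\<in>UNIV. (\<bar>x $ i\<bar> powr \<alpha> + \<epsilon> $ i) powr (p / \<alpha>))"

lemma smoothed_objective_mono:
  assumes "lam \<ge> 0" "p \<ge> 0" "\<alpha> > 0" "\<And>i. 0 \<le> \<delta> $ i" "\<And>i. \<delta> $ i \<le> \<epsilon> $ i"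
  shows "smoothed_objective lam p \<alpha> f \<delta> x \<le> smoothed_objective lam p \<alpha> f \<epsilon> x"
  unfolding smoothed_objective_def
  using assms by (intro add_left_mono mult_left_mono sum_mono powr_mono2) auto

lemma le_smoothed_objective: "lam \<ge> 0 \<Longrightarrow> f x \<le> smoothed_objective lam p \<alpha> f \<epsilon> x"
  unfolding smoothed_objective_def by (simp add: sum_nonneg)

text \<open>\<open>p / \<alpha> * irl_weight\<close> is the slope of
  \<open>s \<mapsto> (s + \<epsilon> $ i) powr (p / \<alpha>)\<close> at
  \<open>s = \<bar>x $ i\<bar> powr \<alpha>\<close>. The reweighted penalty is thus the
  linearisation at \<open>x\<close> of the smoothed one in these variables, and concavity applies in
  each coordinate.\<close>

lemma smoothed_objective_diff_le:
  assumes "lam \<ge> 0" "0 \<le> p" "p \<le> \<alpha>" "\<alpha> > 0" "\<And>i. \<epsilon> $ i > 0"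
  shows "smoothed_objective lam p \<alpha> f \<epsilon> y - smoothed_objective lam p \<alpha> f \<epsilon> x
    \<le> reweighted_objective lam p \<alpha> f (irl_weight \<alpha> p \<epsilon> x) y
      - reweighted_objective lam p \<alpha> f (irl_weight \<alpha> p \<epsilon> x) x"
proof -
  let ?w = "irl_weight \<alpha> p \<epsilon> x"
  have "(\<bar>y $ i\<bar> powr \<alpha> + \<epsilon> $ i) powr (p / \<alpha>) - (\<bar>x $ i\<bar> powr \<alpha> + \<epsilon> $ i) powr (p / \<alpha>)
      \<le> p / \<alpha> * (?w $ i * \<bar>y $ i\<bar> powr \<alpha>) - p / \<alpha> * (?w $ i * \<bar>x $ i\<bar> powr \<alpha>)" for i
    using powr_le_tangent[of "\<bar>x $ i\<bar> powr \<alpha> + \<epsilon> $ i" "\<bar>y $ i\<bar> powr \<alpha> + \<epsilon> $ i" "p / \<alpha>"] assms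
    by (simp add: irl_weight_def add_pos_nonneg algebra_simps diff_divide_distrib)
  then have "lam * (\<Sum>i\<in>UNIV. (\<bar>y $ i\<bar> powr \<alpha> + \<epsilon> $ i) powr (p / \<alpha>)
        - (\<bar>x $ i\<bar> powr \<alpha> + \<epsilon> $ i) powr (p / \<alpha>))
      \<le> lam * (\<Sum>i\<in>UNIV. p / \<alpha> * (?w $ i * \<bar>y $ i\<bar> powr \<alpha>) - p / \<alpha> * (?w $ i * \<bar>x $ i\<bar> powr \<alpha>))"
    using assms by (intro mult_left_mono sum_mono) auto
  then show ?thesis
    by (simp add: smoothed_objective_def reweighted_objective_def sum_subtractf
        right_diff_distrib flip: sum_distrib_left sum_divide_distrib)
qed

text \<open>Only the weight of coordinate \<open>i\<close> survives. This is what keeps the limit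
  argument away from the weights of coordinates that tend to 0, which blow up.\<close>

lemma reweighted_objective_add_axis:
  "reweighted_objective lam p \<alpha> f s (x + t *\<^sub>R axis i 1) - reweighted_objective lam p \<alpha> f s x
   = f (x + t *\<^sub>R axis i 1) - f x
     + lam * p / \<alpha> * s $ i * (\<bar>x $ i + t\<bar> powr \<alpha> - \<bar>x $ i\<bar> powr \<alpha>)"
proof -
  have "(\<Sum>j\<in>UNIV. s $ j * \<bar>(x + t *\<^sub>R axis i 1) $ j\<bar> powr \<alpha> - s $ j * \<bar>x $ j\<bar> powr \<alpha>)
     = (\<Sum>j\<in>{i}. s $ j * \<bar>(x + t *\<^sub>R axis i 1) $ j\<bar> powr \<alpha> - s $ j * \<bar>x $ j\<bar> powr \<alpha>)"
    by (rule sum.mono_neutral_right) (auto simp: axis_def)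
  then have "(\<Sum>j\<in>UNIV. s $ j * \<bar>(x + t *\<^sub>R axis i 1) $ j\<bar> powr \<alpha>)
     = (\<Sum>j\<in>UNIV. s $ j * \<bar>x $ j\<bar> powr \<alpha>) + s $ i * (\<bar>x $ i + t\<bar> powr \<alpha> - \<bar>x $ i\<bar> powr \<alpha>)"
    by (simp add: sum_subtractf axis_def algebra_simps)
  then show ?thesis
    unfolding reweighted_objective_def by (simp only:) (simp add: algebra_simps)
qed

theorem theorem3p6:
  fixes f :: "real ^ 'n \<Rightarrow> real"
    and lam p \<alpha> L :: real
    and \<epsilon> x :: "nat \<Rightarrow> real ^ 'n"
    and xstar :: "real ^ 'n"
  assumes "lam > 0" and "0 < p" and "p < 1" and "\<alpha> \<ge> 1"
    and "\<And>y. f differentiable (at y)"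
    and "continuous_on UNIV (gradient f)"
    and "bdd_below (range f)"
    and "\<And>y z. norm (gradient f y - gradient f z) \<le> L * norm (y - z)"
    and "\<And>k i. \<epsilon> k $ i > 0"
    and "\<And>k i. \<epsilon> (Suc k) $ i \<le> \<epsilon> k $ i"
    and "\<epsilon> \<longlonglongrightarrow> 0"
    and "\<And>k. is_arg_min (reweighted_objective lam p \<alpha> f (irl_weight \<alpha> p (\<epsilon> k) (x k)))
                (\<lambda>_. True) (x (Suc k))"
    and "accumulation_point x xstar"
  shows "lp_stationary_point lam p f xstar"
proof -
  define w where "w k = irl_weight \<alpha> p (\<epsilon> k) (x k)" for k
  define Q where "Q k = reweighted_objective lam p \<alpha> f (w k)" for k
  define F where "F k = smoothed_objective lam p \<alpha> f (\<epsilon> k)" for k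
  have Q_min: "Q k (x (Suc k)) \<le> Q k y" for k y
    using assms(12)[of k] by (auto simp: is_arg_min_def Q_def w_def not_less)
  have descent: "Q k (x k) - Q k (x (Suc k)) \<le> F k (x k) - F (Suc k) (x (Suc k))" for k
  proof -
    have "F k (x (Suc k)) - F k (x k) \<le> Q k (x (Suc k)) - Q k (x k)"
      unfolding F_def Q_def w_def by (rule smoothed_objective_diff_le) (use assms in auto)
    moreover have "F (Suc k) (x (Suc k)) \<le> F k (x (Suc k))"
      unfolding F_def by (rule smoothed_objective_mono) (use assms in \<open>auto intro: less_imp_le\<close>)
    ultimately show ?thesis by simp
  qed
  have gap_tendsto: "(\<lambda>k. F k (x k) - F (Suc k) (x (Suc k))) \<longlonglongrightarrow> 0"
  proof -
    obtain B where B: "B \<le> f y" for y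
      using assms(7) by (auto simp: bdd_below_def)
    have "B \<le> F k (x k)" for k
      using B[of "x k"] le_smoothed_objective[of lam f "x k" p \<alpha> "\<epsilon> k"] \<open>lam > 0\<close>
      by (simp add: F_def)
    moreover have "decseq (\<lambda>k. F k (x k))"
      \<comment> \<open>\<open>Q_min\<close> with \<open>y = x k\<close> makes the left side of
        \<open>descent\<close> nonnegative.\<close>
      using descent Q_min by (intro decseq_SucI) (smt (verit))
    ultimately obtain l where "(\<lambda>k. F k (x k)) \<longlonglongrightarrow> l"
      using decseq_convergent by blast
    from tendsto_diff[OF this LIMSEQ_Suc[OF this]] show ?thesis by simp
  qed
  obtain r where r: "strict_mono r" "(\<lambda>k. x (r k)) \<longlonglongrightarrow> xstar"
    using assms(13) by (auto simp: accumulation_point_def o_def)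
  have f_tendsto: "(\<lambda>k. f (g k)) \<longlonglongrightarrow> f y" if "g \<longlonglongrightarrow> y" for g y
    using isCont_tendsto_compose[OF differentiable_imp_continuous_within[OF assms(5)] that] .
  have "xstar $ i * partial_deriv f i xstar + lam * p * \<bar>xstar $ i\<bar> powr p = 0" for i
  proof (cases "xstar $ i = 0")
    case False
    let ?u = "xstar $ i"
    let ?h = "\<lambda>t. f (xstar + t *\<^sub>R axis i 1)
      + lam * p / \<alpha> * \<bar>?u\<bar> powr (p - \<alpha>) * \<bar>?u + t\<bar> powr \<alpha>"
    have xi: "(\<lambda>k. x (r k) $ i) \<longlonglongrightarrow> ?u"
      by (rule tendsto_vec_nth[OF r(2)])
    have w_tendsto: "(\<lambda>k. w (r k) $ i) \<longlonglongrightarrow> \<bar>?u\<bar> powr (p - \<alpha>)"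
    proof -
      have "(\<lambda>k. \<epsilon> (r k) $ i) \<longlonglongrightarrow> 0"
        using tendsto_vec_nth[OF LIMSEQ_subseq_LIMSEQ[OF assms(11) r(1)], of i]
        by (simp add: o_def)
      \<comment> \<open>The exponent is negative; continuity of \<open>powr\<close> holds here
        because the base has a nonzero limit.\<close>
      then have "(\<lambda>k. w (r k) $ i) \<longlonglongrightarrow> (\<bar>?u\<bar> powr \<alpha> + 0) powr (p / \<alpha> - 1)"
        unfolding w_def irl_weight_def vec_lambda_beta
        using False by (intro tendsto_intros xi) auto
      moreover have "\<alpha> * (p / \<alpha> - 1) = p - \<alpha>"
        using assms(4) by (simp add: field_simps)
      ultimately show ?thesis by (simp add: powr_powr)
    qed
    have h_min: "?h 0 \<le> ?h t" for t
    proof -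
      let ?d = "\<lambda>k. f (x k + t *\<^sub>R axis i 1) - f (x k)
        + lam * p / \<alpha> * w k $ i * (\<bar>x k $ i + t\<bar> powr \<alpha> - \<bar>x k $ i\<bar> powr \<alpha>)"
      \<comment> \<open>The translate is compared with \<open>x k\<close>, not with the minimiser
        \<open>x (Suc k)\<close>: along \<open>r\<close> only the former is known to converge. The
        price is the gap, which vanishes in the limit.\<close>
      have "- (F k (x k) - F (Suc k) (x (Suc k))) \<le> ?d k" for k
        using descent[of k] Q_min[of k "x k + t *\<^sub>R axis i 1"]
          reweighted_objective_add_axis[of lam p \<alpha> f "w k" "x k" t i]
        by (simp add: Q_def)
      moreover have "(\<lambda>k. - (F (r k) (x (r k)) - F (Suc (r k)) (x (Suc (r k))))) \<longlonglongrightarrow> - 0"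
        using LIMSEQ_subseq_LIMSEQ[OF gap_tendsto r(1)] by (intro tendsto_minus) (simp add: o_def)
      moreover have "(\<lambda>k. ?d (r k)) \<longlonglongrightarrow> f (xstar + t *\<^sub>R axis i 1) - f xstar
        + lam * p / \<alpha> * \<bar>?u\<bar> powr (p - \<alpha>) * (\<bar>?u + t\<bar> powr \<alpha> - \<bar>?u\<bar> powr \<alpha>)"
      proof -
        have abs_powr: "(\<lambda>k. \<bar>g k\<bar> powr \<alpha>) \<longlonglongrightarrow> \<bar>v\<bar> powr \<alpha>" if "g \<longlonglongrightarrow> v" for g and v :: real
          \<comment> \<open>The limit \<open>v\<close> may be 0, as when \<open>t = - ?u\<close>;
            nonnegative bases and \<open>\<alpha> > 0\<close> cover this case.\<close>
          by (rule tendsto_powr'[OF tendsto_rabs[OF that] tendsto_const]) (use assms(4) in auto)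
        show ?thesis
          by (intro tendsto_add tendsto_diff tendsto_mult abs_powr f_tendsto w_tendsto r(2) xi tendsto_const)
      qed
      ultimately have "- 0 \<le> f (xstar + t *\<^sub>R axis i 1) - f xstar
        + lam * p / \<alpha> * \<bar>?u\<bar> powr (p - \<alpha>) * (\<bar>?u + t\<bar> powr \<alpha> - \<bar>?u\<bar> powr \<alpha>)"
        by (intro LIMSEQ_le) auto
      then show ?thesis by (simp add: algebra_simps)
    qed
    have "(?h has_real_derivative partial_deriv f i xstar
      + lam * p / \<alpha> * \<bar>?u\<bar> powr (p - \<alpha>) * (\<alpha> * \<bar>?u\<bar> powr (\<alpha> - 1) * sgn ?u)) (at 0)"
      by (intro DERIV_add DERIV_cmult has_real_derivative_partial_deriv
          has_real_derivative_abs_powr assms(5) False)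
    \<comment> \<open>The radius 1 is arbitrary, since \<open>h_min\<close> is global in
      \<open>t\<close>.\<close>
    from DERIV_local_min[OF this zero_less_one] h_min
    have "partial_deriv f i xstar
      + lam * p / \<alpha> * \<bar>?u\<bar> powr (p - \<alpha>) * (\<alpha> * \<bar>?u\<bar> powr (\<alpha> - 1) * sgn ?u) = 0"
      by blast
    moreover have "lam * p / \<alpha> * \<bar>?u\<bar> powr (p - \<alpha>) * (\<alpha> * \<bar>?u\<bar> powr (\<alpha> - 1) * sgn ?u)
      = lam * p * \<bar>?u\<bar> powr (p - 1) * sgn ?u"
      using assms(4) by (simp add: mult.assoc flip: powr_add)
    ultimately have "?u * (partial_deriv f i xstar + lam * p * \<bar>?u\<bar> powr (p - 1) * sgn ?u) = 0"
      by simp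
    moreover have "?u * (lam * p * \<bar>?u\<bar> powr (p - 1) * sgn ?u) = lam * p * \<bar>?u\<bar> powr p"
      using False by (auto simp: powr_diff sgn_if field_simps)
    ultimately show ?thesis by (simp add: distrib_left)
  qed simp
  then show ?thesis by (simp add: lp_stationary_point_def)
qed

end
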